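(* There exists an instance of online inverse linear optimization such that $X_1,\dots,X_T$ are M-convex sets and any randomized algorithm incurs a regret of $$\mathbb{E}[R_T]=\Omega(d).$$
   Context: Notation: $d$ is the dimension of the problem and $T$ is the time horizon; $[d]=\{1,\dots,d\}$; $x(i)$ is the $i$th component of $x\in\mathbb{R}^d$; $\mathbf{e}_i\in\mathbb{R}^d$ is the $i$th standard basis vector; $\langle\cdot,\cdot\rangle$ is the standard inner product. M-convex set: a non-empty set $X\subseteq\mathbb{Z}^d$ such that for any $x,y\in X$ and $i\in[d]$ with $x(i)>y(i)$, there exists $j\in[d]$ with $x(j)<y(j)$ such that $x-\mathbf{e}_i+\mathbf{e}_j\in X$ and $y+\mathbf{e}_i-\mathbf{e}_j\in X$. Online inverse linear optimization: an agent has an objective vector $w^*\in\mathbb{R}^d$ hidden from the learner. For $t=1,\dots,T$, the agent faces a feasible set $X_t$ (here $X_t\subseteq\mathbb{Z}^d$, embedded in $\mathbb{R}^d$) and takes an optimal action $x_t\in\arg\max\{\langle w^*,x\rangle : x\in X_t\}$ (uncorrupted feedback). In each round $t$, the learner computes an estimate $\hat w_t\in\mathbb{R}^d$ based on the information $\{(X_s,x_s)\}_{s=1}^{t-1}$ observed up to round $t-1$ (for simplicity, the learner is supposed to know $X_t$ at the beginning of round $t$). The action suggested by the estimate is $\hat x_t\in\arg\max\{\langle\hat w_t,x\rangle : x\in X_t\}$. The learner then observes the agent's action $x_t$ and the feasible set $X_t$. The learner's regret is $R_T=\sum_{t=1}^T\langle w^*,x_t-\hat x_t\rangle$. Standing assumptions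 of the setting: $\max\{\langle w^*,x-x'\rangle : x,x'\in X_t\}=O(1)$ for all $t$, and the components of $w^*$ are distinct. *)

theory Defs
  imports "HOL-Probability.Probability" "Jordan_Normal_Form.Matrix"
begin

text \<open>
  The dimension \<open>d\<close> varies inside the bound, so vectors are those of the
  Jordan normal form entry, with explicit carrier \<open>carrier_vec d\<close>; coordinates are
  numbered \<open>0, \<dots>, d - 1\<close>.  Rounds are numbered \<open>1, \<dots>, T\<close>.
\<close>

definition M_convex :: "nat \<Rightarrow> int vec set \<Rightarrow> bool" where
  "M_convex d X \<longleftrightarrow> X \<noteq> {} \<and> X \<subseteq> carrier_vec d \<and>
     (\<forall>x\<in>X. \<forall>y\<in>X. \<forall>i<d. x $ i > y $ i \<longrightarrow>
        (\<exists>j<d. x $ j < y $ j \<and> x - unit_vec d i + unit_vec d j \<in> X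
                            \<and> y + unit_vec d i - unit_vec d j \<in> X))"

definition lin_obj :: "real vec \<Rightarrow> int vec \<Rightarrow> real" where
  "lin_obj w x = scalar_prod w (map_vec real_of_int x)"

text \<open>
  Feasible sets are required to be finite, so that every estimate of the learner has a
  maximizer.  The last conjunct is the assumption
  \<open>max {\<langle>w, x - x'\<rangle> | x, x' \<in> X t} = O(1)\<close>, with \<open>B\<close> as the constant.
\<close>

definition inv_opt_instance ::
  "nat \<Rightarrow> nat \<Rightarrow> real \<Rightarrow> (nat \<Rightarrow> int vec set) \<Rightarrow> real vec \<Rightarrow> (nat \<Rightarrow> int vec) \<Rightarrow> bool" where
  "inv_opt_instance d T B X w x \<longleftrightarrow>
     w \<in> carrier_vec d \<and> inj_on (\<lambda>i. w $ i) {..<d} \<and>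
     (\<forall>t\<in>{1..T}. finite (X t) \<and> X t \<noteq> {} \<and> X t \<subseteq> carrier_vec d \<and>
        is_arg_max (lin_obj w) (\<lambda>z. z \<in> X t) (x t) \<and>
        (\<forall>z\<in>X t. \<forall>z'\<in>X t. lin_obj w (z - z') \<le> B))"

type_synonym observations = "(int vec set \<times> int vec) list"

definition observed :: "(nat \<Rightarrow> int vec set) \<Rightarrow> (nat \<Rightarrow> int vec) \<Rightarrow> nat \<Rightarrow> observations" where
  "observed X x t = map (\<lambda>s. (X s, x s)) [1..<t]"

text \<open>
  A randomized learner draws a seed \<open>\<omega>\<close> from a probability space \<open>M\<close> once; in each round
  the estimate \<open>est \<omega> h Y\<close> is determined by the seed, the past observations \<open>h\<close> and the
  current feasible set \<open>Y\<close>.  An estimate can have several maximizers; \<open>act\<close> is the learner's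
  tie-breaking, which is likewise allowed to depend on \<open>\<omega>\<close>, \<open>h\<close> and \<open>Y\<close> (but not on the hidden
  objective).  Measurability is only imposed on the suggested actions, which are all that
  enters the regret.
\<close>

definition randomized_learner ::
  "nat \<Rightarrow> 'a measure \<Rightarrow> ('a \<Rightarrow> observations \<Rightarrow> int vec set \<Rightarrow> real vec)
     \<Rightarrow> ('a \<Rightarrow> observations \<Rightarrow> int vec set \<Rightarrow> int vec) \<Rightarrow> bool" where
  "randomized_learner d M est act \<longleftrightarrow> prob_space M \<and>
     (\<forall>h Y. finite Y \<and> M_convex d Y \<longrightarrow>
        (\<forall>\<omega>\<in>space M. est \<omega> h Y \<in> carrier_vec d \<and>
                      is_arg_max (lin_obj (est \<omega> h Y)) (\<lambda>z. z \<in> Y) (act \<omega> h Y)) \<and>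
        (\<lambda>\<omega>. act \<omega> h Y) \<in> measurable M (count_space UNIV))"

definition regret ::
  "nat \<Rightarrow> real vec \<Rightarrow> (nat \<Rightarrow> int vec) \<Rightarrow> (nat \<Rightarrow> int vec) \<Rightarrow> real" where
  "regret T w x x' = (\<Sum>t=1..T. lin_obj w (x t - x' t))"

text \<open>
  This is the expectation over the learner's seed for one fixed objective \<open>w\<close>.  No fixed pair of
  feasible sets and objective is hard for every learner (the constant estimate \<open>w\<close> can have no
  regret), so a hard instance is a random one: \<open>w\<close> is drawn independently of the seed from a
  distribution fixed before the learner, and expected regret is averaged over it.
\<close>

definition expected_regret ::
  "nat \<Rightarrow> (nat \<Rightarrow> int vec set) \<Rightarrow> real vec \<Rightarrow> (nat \<Rightarrow> int vec)
     \<Rightarrow> 'a measure \<Rightarrow> ('a \<Rightarrow> observations \<Rightarrow> int vec set \<Rightarrow> int vec) \<Rightarrow> real" where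
  "expected_regret T X w x M act =
     (LINT \<omega>|M. regret T w x (\<lambda>t. act \<omega> (observed X x t) (X t)))"

end

theory Submission
  imports Defs
begin

text \<open>
  In round \<open>t \<le> d div 2\<close> the learner chooses between two standard basis vectors whose
  coordinates occur in no other round, and a fair coin, independent of everything seen before,
  decides which of the two has the larger weight.  The two weights differ by \<open>B\<close>, so every such
  round costs \<open>B / 2\<close> on average.  Independence enters through an involution: flipping the
  \<open>t\<close>-th coin leaves the history before round \<open>t\<close> unchanged and exchanges the losses of the
  two choices, which add up to \<open>B\<close>.
\<close>

section \<open>Linear objectives and pairs of unit vectors\<close>

lemma lin_obj_minus:
  assumes "w \<in> carrier_vec d" "z \<in> carrier_vec d" "z' \<in> carrier_vec d"
  shows "lin_obj w (z - z') = lin_obj w z - lin_obj w z'"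
proof -
  have "map_vec real_of_int (z - z') = map_vec real_of_int z - map_vec real_of_int z'"
    using assms by (intro eq_vecI) auto
  then show ?thesis
    using assms by (simp add: lin_obj_def scalar_prod_minus_distrib[of _ d])
qed

lemma lin_obj_unit_vec:
  assumes "w \<in> carrier_vec d" "i < d"
  shows "lin_obj w (unit_vec d i) = w $ i"
proof -
  have "map_vec real_of_int (unit_vec d i) = unit_vec d i"
    by (intro eq_vecI) (auto simp: unit_vec_def)
  then show ?thesis
    using assms by (simp add: lin_obj_def)
qed

text \<open>The only coordinate in which one unit vector exceeds the other is its own index, and
  exchanging that index for the other one just swaps the two vectors. The case \<open>i = j\<close>
  is allowed and covers singletons.\<close>

lemma M_convex_unit_vec_pair:
  assumes "i < d" "j < d"
  shows "M_convex d {unit_vec d i, unit_vec d j}"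
proof -
  have swap: "unit_vec d a - unit_vec d a + unit_vec d b = (unit_vec d b :: int vec)"
    "unit_vec d b + unit_vec d a - unit_vec d b = (unit_vec d a :: int vec)" for a b
    by (auto intro!: eq_vecI)
  have exchange: "\<exists>l<d. unit_vec d a $ l < (unit_vec d b $ l :: int) \<and>
      unit_vec d a - unit_vec d k + unit_vec d l \<in> {unit_vec d i, unit_vec d j :: int vec} \<and>
      unit_vec d b + unit_vec d k - unit_vec d l \<in> {unit_vec d i, unit_vec d j :: int vec}"
    if "a \<in> {i, j}" "b \<in> {i, j}" "k < d" "unit_vec d a $ k > (unit_vec d b $ k :: int)" for a b k
  proof -
    have "a < d" "b < d" "k = a" "a \<noteq> b"
      using that assms by (auto simp: unit_vec_def split: if_splits)
    then show ?thesis
      using that(1,2) swap by (intro exI[of _ b]) auto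
  qed
  then have "\<forall>x\<in>{unit_vec d i, unit_vec d j}. \<forall>y\<in>{unit_vec d i, unit_vec d j}. \<forall>k<d. x $ k > y $ k \<longrightarrow>
      (\<exists>l<d. x $ l < y $ l \<and>
        x - unit_vec d k + unit_vec d l \<in> {unit_vec d i, unit_vec d j} \<and>
        y + unit_vec d k - unit_vec d l \<in> {unit_vec d i, unit_vec d j :: int vec})"
    by blast
  then show ?thesis
    unfolding M_convex_def by auto
qed

section \<open>The random instance\<close>

text \<open>Rounds count from 1 and coordinates from 0, so round \<open>t\<close> owns the
  coordinates \<open>2 * t - 2\<close> and \<open>2 * t - 1\<close>. The singletons pad the horizon
  with rounds that cost nothing.\<close>

definition coin_set :: "nat \<Rightarrow> nat \<Rightarrow> int vec set" where
  "coin_set d t =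
     (if t \<in> {1..d div 2} then {unit_vec d (2 * t - 2), unit_vec d (2 * t - 1)}
      else {unit_vec d 0})"

text \<open>\<open>A\<close> is the set of rounds in which the even coordinate \<open>2 * t - 2\<close> is the better one.\<close>

definition coin_weight :: "real \<Rightarrow> nat \<Rightarrow> nat set \<Rightarrow> real vec" where
  "coin_weight B d A =
     vec d (\<lambda>i. 2 * B * real (i div 2) + (if even i \<longleftrightarrow> Suc (i div 2) \<in> A then B else 0))"

text \<open>The agent's choice is a function of \<open>w\<close> rather than of the coins
  \<open>A\<close>, because the theorem draws \<open>w\<close> itself from a distribution.\<close>

definition best_action :: "nat \<Rightarrow> real vec \<Rightarrow> nat \<Rightarrow> int vec" where
  "best_action d w t =
     (if t \<in> {1..d div 2}
      then unit_vec d (if w $ (2 * t - 2) > w $ (2 * t - 1) then 2 * t - 2 else 2 * t - 1)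
      else unit_vec d 0)"

lemma coin_set_carrier: "coin_set d t \<subseteq> carrier_vec d"
  by (auto simp: coin_set_def)

lemma M_convex_coin_set:
  assumes "d \<ge> 2"
  shows "M_convex d (coin_set d t)"
proof (cases "t \<in> {1..d div 2}")
  case True
  then have "2 * t - 2 < d" "2 * t - 1 < d"
    by auto
  then show ?thesis
    using True by (simp add: coin_set_def M_convex_unit_vec_pair)
next
  case False
  then show ?thesis
    using assms M_convex_unit_vec_pair[of 0 d 0] by (auto simp: coin_set_def)
qed

lemma coin_weight_carrier: "coin_weight B d A \<in> carrier_vec d"
  by (simp add: coin_weight_def)

text \<open>Successive pairs are offset by \<open>2 * B\<close> while a coin adds at most
  \<open>B\<close>, so different pairs cannot collide. Within a pair exactly one coordinate receives
  the extra \<open>B\<close>.\<close>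

lemma coin_weight_inj:
  assumes "B > 0"
  shows "inj_on (\<lambda>i. coin_weight B d A $ i) {..<d}"
proof (rule inj_onI)
  fix i j
  assume ij: "i \<in> {..<d}" "j \<in> {..<d}" and eq: "coin_weight B d A $ i = coin_weight B d A $ j"
  \<comment> \<open>After division by \<open>B\<close> a weight is a natural number with quotient
    \<open>k div 2\<close> and remainder \<open>e k\<close> modulo 2.\<close>
  define e where "e k = (if even k \<longleftrightarrow> Suc (k div 2) \<in> A then 1 else 0 :: nat)" for k
  have "coin_weight B d A $ k = B * real (2 * (k div 2) + e k)" if "k < d" for k
    using that by (simp add: coin_weight_def e_def algebra_simps)
  with eq ij assms have "real (2 * (i div 2) + e i) = real (2 * (j div 2) + e j)"
    by simp
  then have eq': "2 * (i div 2) + e i = 2 * (j div 2) + e j"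
    by (simp only: of_nat_eq_iff)
  moreover have "e i \<le> 1" "e j \<le> 1"
    by (auto simp: e_def)
  ultimately have "i div 2 = j div 2"
    by linarith
  moreover from this eq' have "even i \<longleftrightarrow> even j"
    by (auto simp: e_def split: if_splits)
  ultimately show "i = j"
    by (metis bit_eq_rec)
qed

lemma coin_weight_pair:
  assumes "t \<in> {1..d div 2}"
  shows "coin_weight B d A $ (2 * t - 2) = 2 * B * real (t - 1) + (if t \<in> A then B else 0)"
    and "coin_weight B d A $ (2 * t - 1) = 2 * B * real (t - 1) + (if t \<in> A then 0 else B)"
proof -
  obtain k where t: "t = Suc k"
    using assms by (cases t) auto
  have "2 * k < d" "Suc (2 * k) < d"
    using assms t by auto
  then show "coin_weight B d A $ (2 * t - 2) = 2 * B * real (t - 1) + (if t \<in> A then B else 0)"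
    and "coin_weight B d A $ (2 * t - 1) = 2 * B * real (t - 1) + (if t \<in> A then 0 else B)"
    by (auto simp: coin_weight_def t)
qed

lemma lin_obj_coin_weight:
  assumes "t \<in> {1..d div 2}"
  shows "lin_obj (coin_weight B d A) (unit_vec d (2 * t - 2)) =
      2 * B * real (t - 1) + (if t \<in> A then B else 0)"
    and "lin_obj (coin_weight B d A) (unit_vec d (2 * t - 1)) =
      2 * B * real (t - 1) + (if t \<in> A then 0 else B)"
proof -
  have "2 * t - 2 < d" "2 * t - 1 < d"
    using assms by auto
  then show "lin_obj (coin_weight B d A) (unit_vec d (2 * t - 2)) =
      2 * B * real (t - 1) + (if t \<in> A then B else 0)"
    and "lin_obj (coin_weight B d A) (unit_vec d (2 * t - 1)) =
      2 * B * real (t - 1) + (if t \<in> A then 0 else B)"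
    using coin_weight_pair[OF assms] lin_obj_unit_vec[OF coin_weight_carrier] by simp_all
qed

lemma best_action_coin_weight:
  assumes "B > 0"
  shows "best_action d (coin_weight B d A) t =
    (if t \<in> {1..d div 2} then unit_vec d (if t \<in> A then 2 * t - 2 else 2 * t - 1)
     else unit_vec d 0)"
proof (cases "t \<in> {1..d div 2}")
  case True
  then show ?thesis
    using coin_weight_pair[OF True, of B A] assms by (simp add: best_action_def)
qed (auto simp: best_action_def)

lemma inv_opt_instance_coin:
  assumes "B > 0"
  shows "inv_opt_instance d T B (coin_set d) (coin_weight B d A)
    (best_action d (coin_weight B d A))"
proof -
  let ?w = "coin_weight B d A"
  have fin: "finite (coin_set d t)" "coin_set d t \<noteq> {}" for t
    by (auto simp: coin_set_def)
  have opt: "is_arg_max (lin_obj ?w) (\<lambda>z. z \<in> coin_set d t) (best_action d ?w t)" for t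
  proof (cases "t \<in> {1..d div 2}")
    case True
    then show ?thesis
      using assms lin_obj_coin_weight[OF True, of B A]
      by (auto simp: best_action_coin_weight is_arg_max_linorder coin_set_def)
  next
    case False
    then show ?thesis
      by (auto simp: best_action_def is_arg_max_linorder coin_set_def)
  qed
  \<comment> \<open>Both candidates of a round carry the same offset, which cancels. Hence the gap
    is bounded by \<open>B\<close> although the weights grow with the round.\<close>
  have gap: "lin_obj ?w (z - z') \<le> B" if "z \<in> coin_set d t" "z' \<in> coin_set d t" for t z z'
  proof -
    have "lin_obj ?w (z - z') = lin_obj ?w z - lin_obj ?w z'"
      using that coin_set_carrier by (intro lin_obj_minus[of _ d] coin_weight_carrier) auto
    also have "\<dots> \<le> B"
    proof (cases "t \<in> {1..d div 2}")
      case True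
      then show ?thesis
        using that assms lin_obj_coin_weight[OF True, of B A] by (auto simp: coin_set_def)
    next
      case False
      then show ?thesis
        using that assms by (auto simp: coin_set_def)
    qed
    finally show ?thesis .
  qed
  show ?thesis
    unfolding inv_opt_instance_def
    using fin coin_set_carrier opt gap coin_weight_carrier coin_weight_inj[OF assms] by blast
qed

section \<open>Histories and flipped coins\<close>

lemma observed_cong:
  assumes "\<And>s. s \<in> {1..<t} \<Longrightarrow> x s = y s"
  shows "observed X x t = observed X y t"
  using assms by (simp add: observed_def)

text \<open>Symmetric difference with \<open>{t}\<close>.\<close>

definition flip :: "'b \<Rightarrow> 'b set \<Rightarrow> 'b set" where
  "flip t A = (if t \<in> A then A - {t} else insert t A)"

lemma flip_flip [simp]: "flip t (flip t A) = A"
  by (auto simp: flip_def)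

lemma mem_flip [simp]: "s \<in> flip t A \<longleftrightarrow> (if s = t then t \<notin> A else s \<in> A)"
  by (auto simp: flip_def)

lemma flip_subset_iff [simp]: "t \<in> S \<Longrightarrow> flip t A \<subseteq> S \<longleftrightarrow> A \<subseteq> S"
  by (auto simp: flip_def)

text \<open>Since \<open>flip t\<close> permutes \<open>Pow S\<close>, adding the sum to its
  reindexed copy yields \<open>c\<close> once for each subset.\<close>

lemma sum_flip:
  fixes f :: "'b set \<Rightarrow> real"
  assumes "finite S" "t \<in> S" and "\<And>A. A \<subseteq> S \<Longrightarrow> f A + f (flip t A) = c"
  shows "(\<Sum>A\<in>Pow S. f A) = 2 ^ card S * c / 2"
proof -
  have "(\<Sum>A\<in>Pow S. f A) = (\<Sum>A\<in>Pow S. f (flip t A))"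
    using assms(2)
    by (intro sum.reindex_bij_witness[of _ "flip t" "flip t"]) simp_all
  then have "2 * (\<Sum>A\<in>Pow S. f A) = (\<Sum>A\<in>Pow S. f A + f (flip t A))"
    by (simp add: sum.distrib)
  also have "\<dots> = 2 ^ card S * c"
    using assms by (simp add: card_Pow)
  finally show ?thesis
    by simp
qed

section \<open>Regret averaged over the coins\<close>

text \<open>The seed is fixed here, so \<open>act\<close> is a deterministic strategy. Only
  feasibility of its actions is used, which covers every estimate and every tie-breaking rule; the
  average is the same for all of them.\<close>

lemma sum_regret_coin:
  fixes act :: "observations \<Rightarrow> int vec set \<Rightarrow> int vec"
  assumes "B > 0" and "d div 2 \<le> T"
    and act: "\<And>h t. act h (coin_set d t) \<in> coin_set d t"
  shows "(\<Sum>A\<in>Pow {1..d div 2}.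
      regret T (coin_weight B d A) (best_action d (coin_weight B d A))
        (\<lambda>t. act (observed (coin_set d) (best_action d (coin_weight B d A)) t) (coin_set d t)))
    = 2 ^ (d div 2) * (real (d div 2) * B / 2)"
proof -
  let ?w = "coin_weight B d" and ?b = "\<lambda>A. best_action d (coin_weight B d A)"
  define z where "z A t = act (observed (coin_set d) (?b A) t) (coin_set d t)" for A t
  define loss where "loss A t = lin_obj (?w A) (?b A t - z A t)" for A t
  have carrier: "?b A t \<in> carrier_vec d" "z A t \<in> carrier_vec d" for A t
    using subsetD[OF coin_set_carrier act] by (simp_all add: best_action_def z_def)
  have loss: "loss A t = lin_obj (?w A) (?b A t) - lin_obj (?w A) (z A t)" for A t
    unfolding loss_def by (intro lin_obj_minus[of _ d] carrier coin_weight_carrier)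
  have late: "(\<Sum>A\<in>Pow {1..d div 2}. loss A t) = 0" if "t \<notin> {1..d div 2}" for t
  proof -
    have "z A t \<in> coin_set d t" for A
      by (simp add: z_def act)
    then have "z A t = ?b A t" for A
      using that by (auto simp: coin_set_def best_action_def)
    then show ?thesis
      by (simp add: loss)
  qed
  have early: "(\<Sum>A\<in>Pow {1..d div 2}. loss A t) = 2 ^ (d div 2) * B / 2"
    if t: "t \<in> {1..d div 2}" for t
  proof -
    have "loss A t + loss (flip t A) t = B" for A
    proof -
      \<comment> \<open>The history stops before round \<open>t\<close>, so it involves only coins
        \<open>s < t\<close>, and the feasible sets do not depend on \<open>A\<close>. The learner
        therefore acts identically under \<open>A\<close> and \<open>flip t A\<close>.\<close>
      have "observed (coin_set d) (?b (flip t A)) t = observed (coin_set d) (?b A) t"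
        using assms(1) by (intro observed_cong) (simp add: best_action_coin_weight)
      then have eq: "z (flip t A) t = z A t"
        by (simp add: z_def)
      \<comment> \<open>Whichever of the two vectors is chosen, it is optimal under exactly one of
        \<open>A\<close> and \<open>flip t A\<close> and loses \<open>B\<close> under the
        other.\<close>
      have "z A t \<in> {unit_vec d (2 * t - 2), unit_vec d (2 * t - 1)}"
        using act[of _ t] t by (simp add: z_def coin_set_def)
      then show ?thesis
        using t lin_obj_coin_weight[OF t, of B A] lin_obj_coin_weight[OF t, of B "flip t A"]
        by (auto simp: loss eq best_action_coin_weight[OF assms(1)])
    qed
    then show ?thesis
      using sum_flip[of "{1..d div 2}" t "\<lambda>A. loss A t" B] t by simp
  qed
  \<comment> \<open>The coins are averaged round by round, because each round needs its own
    involution.\<close>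
  have "(\<Sum>A\<in>Pow {1..d div 2}. \<Sum>t=1..T. loss A t) = (\<Sum>t=1..T. \<Sum>A\<in>Pow {1..d div 2}. loss A t)"
    by (rule sum.swap)
  also have "\<dots> = (\<Sum>t=1..d div 2. \<Sum>A\<in>Pow {1..d div 2}. loss A t)"
    using assms(2) late by (intro sum.mono_neutral_right) auto
  also have "\<dots> = (\<Sum>t=1..d div 2. 2 ^ (d div 2) * B / 2)"
    by (rule sum.cong[OF refl early])
  also have "\<dots> = 2 ^ (d div 2) * (real (d div 2) * B / 2)"
    by simp
  finally show ?thesis
    by (simp add: regret_def loss_def z_def)
qed

text \<open>The average over the coins is the same constant for every seed. Exchanging the finite
  sum over \<open>A\<close> with the integral over seeds leaves the integral of that
  constant.\<close>

lemma expectation_expected_regret_coin: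
  fixes M :: "'a measure"
  assumes "B > 0" and "d \<ge> 2" and "d div 2 \<le> T" and learner: "randomized_learner d M est act"
  shows "measure_pmf.expectation (map_pmf (coin_weight B d) (pmf_of_set (Pow {1..d div 2})))
      (\<lambda>w. expected_regret T (coin_set d) w (best_action d w) M act) = real (d div 2) * B / 2"
proof -
  interpret prob_space M
    using learner by (simp add: randomized_learner_def)
  have conv: "finite (coin_set d t)" "M_convex d (coin_set d t)" for t
    using M_convex_coin_set[OF assms(2)] by (auto simp: coin_set_def)
  have act: "act \<omega> h (coin_set d t) \<in> coin_set d t" if "\<omega> \<in> space M" for \<omega> h t
    using learner conv that unfolding randomized_learner_def is_arg_max_def by blast
  have meas: "(\<lambda>\<omega>. act \<omega> h (coin_set d t)) \<in> measurable M (count_space UNIV)" for h t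
    using learner conv unfolding randomized_learner_def by blast
  define R where "R A \<omega> = regret T (coin_weight B d A) (best_action d (coin_weight B d A))
      (\<lambda>t. act \<omega> (observed (coin_set d) (best_action d (coin_weight B d A)) t) (coin_set d t))"
    for A \<omega>
  \<comment> \<open>For fixed \<open>A\<close> the history is deterministic, so each loss is a
    function \<open>g\<close> of one random action. That action takes finitely many values, which
    makes \<open>g\<close> bounded along it.\<close>
  have integrable_comp: "integrable M (\<lambda>\<omega>. g (act \<omega> h (coin_set d t)))"
    for g :: "int vec \<Rightarrow> real" and h t
  proof (rule integrable_const_bound)
    show "AE \<omega> in M. norm (g (act \<omega> h (coin_set d t))) \<le> (\<Sum>z\<in>coin_set d t. \<bar>g z\<bar>)"
      using act conv(1) by (intro AE_I2) (auto intro!: member_le_sum)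
    show "(\<lambda>\<omega>. g (act \<omega> h (coin_set d t))) \<in> borel_measurable M"
      by (rule measurable_compose[OF meas]) simp
  qed
  have int: "integrable M (R A)" for A
    unfolding R_def regret_def by (intro Bochner_Integration.integrable_sum integrable_comp)
  let ?E = "\<lambda>w. expected_regret T (coin_set d) w (best_action d w) M act"
  have "measure_pmf.expectation (map_pmf (coin_weight B d) (pmf_of_set (Pow {1..d div 2}))) ?E
      = (\<Sum>A\<in>Pow {1..d div 2}. LINT \<omega>|M. R A \<omega>) / 2 ^ (d div 2)"
    by (simp add: integral_pmf_of_set Pow_not_empty card_Pow expected_regret_def R_def)
  also have "(\<Sum>A\<in>Pow {1..d div 2}. LINT \<omega>|M. R A \<omega>)
      = (LINT \<omega>|M. (\<Sum>A\<in>Pow {1..d div 2}. R A \<omega>))"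
    using int by (intro Bochner_Integration.integral_sum[symmetric])
  also have "\<dots> = (LINT \<omega>|M. 2 ^ (d div 2) * (real (d div 2) * B / 2))"
    unfolding R_def using act
    by (intro Bochner_Integration.integral_cong refl sum_regret_coin assms) auto
  finally show ?thesis
    by (simp add: prob_space)
qed

theorem theorem6p1:
  fixes B :: real
  assumes "B > 0"
  shows "\<exists>c>0. \<forall>d\<ge>2. \<forall>T\<ge>d.
    \<exists>(X :: nat \<Rightarrow> int vec set) (P :: real vec pmf) (x :: real vec \<Rightarrow> nat \<Rightarrow> int vec).
      (\<forall>t\<in>{1..T}. M_convex d (X t)) \<and>
      (\<forall>w\<in>set_pmf P. inv_opt_instance d T B X w (x w)) \<and>
      (\<forall>(M :: 'a measure) est act. randomized_learner d M est act \<longrightarrow>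
         measure_pmf.expectation P (\<lambda>w. expected_regret T X w (x w) M act) \<ge> c * real d)"
proof (rule exI[of _ "B / 6"], intro conjI allI impI)
  show "B / 6 > 0"
    using assms by simp
next
  fix d T :: nat
  assume d: "d \<ge> 2" and T: "T \<ge> d"
  \<comment> \<open>A uniformly random subset of the rounds amounts to independent fair
    coins.\<close>
  let ?P = "map_pmf (coin_weight B d) (pmf_of_set (Pow {1..d div 2}))"
  \<comment> \<open>For \<open>d \<ge> 2\<close> the number of coin rounds is at least
    \<open>d / 3\<close>, with equality at \<open>d = 3\<close>. With average cost
    \<open>B / 2\<close> per coin round this gives the constant \<open>B / 6\<close>.\<close>
  have "real d \<le> real (3 * (d div 2))"
    using d by (simp only: of_nat_le_iff)
  then have "B / 6 * real d \<le> real (d div 2) * B / 2"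
    using mult_left_mono[of "real d" "3 * real (d div 2)" "B / 6"] assms by simp
  moreover have "d div 2 \<le> T"
    using T by simp
  ultimately have bound: "measure_pmf.expectation ?P
      (\<lambda>w. expected_regret T (coin_set d) w (best_action d w) M act) \<ge> B / 6 * real d"
    if "randomized_learner d M est act" for M :: "'a measure" and est act
    by (subst expectation_expected_regret_coin[OF assms d _ that])
  show "\<exists>X (P :: real vec pmf) x.
      (\<forall>t\<in>{1..T}. M_convex d (X t)) \<and>
      (\<forall>w\<in>set_pmf P. inv_opt_instance d T B X w (x w)) \<and>
      (\<forall>(M :: 'a measure) est act. randomized_learner d M est act \<longrightarrow>
         measure_pmf.expectation P (\<lambda>w. expected_regret T X w (x w) M act) \<ge> B / 6 * real d)"
  proof (intro exI[of _ "coin_set d"] exI[of _ ?P] exI[of _ "best_action d"] conjI allI impI ballI)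
    fix w
    assume "w \<in> set_pmf ?P"
    then obtain A where "w = coin_weight B d A"
      by auto
    then show "inv_opt_instance d T B (coin_set d) w (best_action d w)"
      using inv_opt_instance_coin[OF assms] by simp
  qed (rule M_convex_coin_set[OF d], erule bound)
qed

end
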